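(* Let $G$ be a group equipped with a $G$-invariant $\sigma$-algebra $\Sigma$, and let $\mu,\theta$ be two probability measures on $(G,\Sigma)$ such that $\theta\ll\sum_{n\ge 0}\frac{1}{2^{n+1}}\mu^{*n}$ and $$\left\|\theta*\mu^{*t}-\mu^{*t}*\theta\right\|_{TV}\to 0\quad\text{as } t\to\infty .$$ Then $H^\infty(G,\mu)\subseteq H^\infty(G,\theta)$; that is, every bounded $\mu$-harmonic function on $G$ is $\theta$-harmonic.
   Context: $G$-invariant means that $\Sigma$ is closed under translations by elements of $G$; it is implicit that multiplication $G\times G\to G$ is measurable from $\Sigma\otimes\Sigma$ to $\Sigma$, so that convolutions make sense. The convolution $\mu*\theta$ is the law of the product $XY$ where $X\sim\mu$, $Y\sim\theta$ are independent; $\mu^{*n}$ is the $n$-th convolution power, with $\mu^{*0}=\delta_e$. $\|\cdot\|_{TV}$ is the total-variation norm of a signed measure. For a probability measure $\mu$ on $(G,\Sigma)$, a function $h\colon G\to\mathbb{C}$ is $\mu$-harmonic if it is measurable, integrable where needed, and $h(g)=\int_G h(g\gamma)\,d\mu(\gamma)$ for all $g\in G$; $H^\infty(G,\mu)$ is the set of all bounded $\mu$-harmonic functions. No topological assumption on $G$ is made. *)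

theory Defs
  imports "HOL-Probability.Probability" "HOL-Algebra.Coset"
begin

definition invariant_sigma_algebra :: "('a, 'b) monoid_scheme \<Rightarrow> 'a set set \<Rightarrow> bool" where
  "invariant_sigma_algebra G S \<longleftrightarrow>
     sigma_algebra (carrier G) S \<and>
     (\<forall>g\<in>carrier G. \<forall>A\<in>S. g <#\<^bsub>G\<^esub> A \<in> S \<and> A #>\<^bsub>G\<^esub> g \<in> S)"

definition measurable_mult :: "('a, 'b) monoid_scheme \<Rightarrow> 'a set set \<Rightarrow> bool" where
  "measurable_mult G S \<longleftrightarrow>
     (\<lambda>(x, y). x \<otimes>\<^bsub>G\<^esub> y)
       \<in> sigma (carrier G) S \<Otimes>\<^sub>M sigma (carrier G) S \<rightarrow>\<^sub>M sigma (carrier G) S"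

definition group_convolution ::
  "('a, 'b) monoid_scheme \<Rightarrow> 'a measure \<Rightarrow> 'a measure \<Rightarrow> 'a measure" where
  "group_convolution G \<mu> \<nu> = distr (\<mu> \<Otimes>\<^sub>M \<nu>) \<mu> (\<lambda>(x, y). x \<otimes>\<^bsub>G\<^esub> y)"

primrec convolution_power ::
  "('a, 'b) monoid_scheme \<Rightarrow> 'a measure \<Rightarrow> nat \<Rightarrow> 'a measure" where
  "convolution_power G \<mu> 0 = return \<mu> \<one>\<^bsub>G\<^esub>"
| "convolution_power G \<mu> (Suc n) = group_convolution G (convolution_power G \<mu> n) \<mu>"

definition geometric_mixture :: "('a, 'b) monoid_scheme \<Rightarrow> 'a measure \<Rightarrow> 'a measure" where
  "geometric_mixture G \<mu> =
     measure_of (space \<mu>) (sets \<mu>)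
       (\<lambda>A. \<Sum>n. ennreal (1 / 2 ^ (n + 1)) * emeasure (convolution_power G \<mu> n) A)"

text \<open>The total variation norm of a signed measure \<open>\<nu>\<close> on the \<open>\<sigma>\<close>-algebra of \<open>M\<close>:
  the supremum of \<open>\<Sum>\<bar>\<nu> A\<bar>\<close> over finite measurable partitions of the space. With this
  normalisation, two mutually singular probability measures are at distance 2.\<close>

definition tv_norm :: "'a measure \<Rightarrow> ('a set \<Rightarrow> real) \<Rightarrow> ennreal" where
  "tv_norm M \<nu> =
     (SUP P \<in> {P. finite P \<and> P \<subseteq> sets M \<and> partition_on (space M) P}.
        \<Sum>A\<in>P. ennreal \<bar>\<nu> A\<bar>)"

text \<open>Functions on \<open>G\<close> are functions on the type \<open>'a\<close> whose values off the carrier are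
  irrelevant: both definitions below only look at the restriction to the carrier.\<close>

definition harmonic ::
  "('a, 'b) monoid_scheme \<Rightarrow> 'a measure \<Rightarrow> ('a \<Rightarrow> complex) \<Rightarrow> bool" where
  "harmonic G \<mu> h \<longleftrightarrow>
     h \<in> borel_measurable \<mu> \<and>
     (\<forall>g\<in>carrier G. integrable \<mu> (\<lambda>\<gamma>. h (g \<otimes>\<^bsub>G\<^esub> \<gamma>)) \<and>
        h g = (\<integral>\<gamma>. h (g \<otimes>\<^bsub>G\<^esub> \<gamma>) \<partial>\<mu>))"

definition H_infinity ::
  "('a, 'b) monoid_scheme \<Rightarrow> 'a measure \<Rightarrow> ('a \<Rightarrow> complex) set" where
  "H_infinity G \<mu> = {h. harmonic G \<mu> h \<and> bounded (h ` carrier G)}"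

lemma sets_group_convolution [simp]: "sets (group_convolution G \<mu> \<nu>) = sets \<mu>"
  by (simp add: group_convolution_def)

lemma space_group_convolution [simp]: "space (group_convolution G \<mu> \<nu>) = space \<mu>"
  by (simp add: group_convolution_def)

lemma sets_convolution_power [simp]: "sets (convolution_power G \<mu> n) = sets \<mu>"
  by (induction n) auto

lemma space_convolution_power [simp]: "space (convolution_power G \<mu> n) = space \<mu>"
  by (induction n) auto

lemma sets_geometric_mixture [simp]: "sets (geometric_mixture G \<mu>) = sets \<mu>"
  by (simp add: geometric_mixture_def)

lemma space_geometric_mixture [simp]: "space (geometric_mixture G \<mu>) = space \<mu>"
  by (simp add: geometric_mixture_def)

lemma emeasure_geometric_mixture:
  assumes "A \<in> sets \<mu>"
  shows "emeasure (geometric_mixture G \<mu>) A =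
     (\<Sum>n. ennreal (1 / 2 ^ (n + 1)) * emeasure (convolution_power G \<mu> n) A)"
proof -
  let ?f = "\<lambda>A. \<Sum>n. ennreal (1 / 2 ^ (n + 1)) * emeasure (convolution_power G \<mu> n) A"
  have "countably_additive (sets \<mu>) ?f"
  proof (rule countably_additiveI)
    fix B :: "nat \<Rightarrow> 'a set"
    assume B: "range B \<subseteq> sets \<mu>" "disjoint_family B" "(\<Union>i. B i) \<in> sets \<mu>"
    have "(\<Sum>i. ?f (B i)) =
      (\<Sum>n i. ennreal (1 / 2 ^ (n + 1)) * emeasure (convolution_power G \<mu> n) (B i))"
      unfolding nn_integral_count_space_nat[symmetric]
      by (rule pair_sigma_finite.Fubini')
         (auto simp: pair_sigma_finite_def sigma_finite_measure_count_space pair_measure_countable)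
    also have "\<dots> = ?f (\<Union>i. B i)"
      using B by (simp add: suminf_emeasure)
    finally show "(\<Sum>i. ?f (B i)) = ?f (\<Union>i. B i)" .
  qed
  moreover have "positive (sets \<mu>) ?f"
    by (simp add: positive_def)
  ultimately show ?thesis
    using assms unfolding geometric_mixture_def
    by (intro emeasure_measure_of_sigma) (auto simp: sets.sigma_algebra_axioms)
qed

lemma sets_eq_imp_space_carrier:
  assumes "invariant_sigma_algebra G S" "sets \<mu> = S"
  shows "space \<mu> = carrier G"
proof -
  interpret sigma_algebra "carrier G" S
    using assms(1) by (simp add: invariant_sigma_algebra_def)
  show ?thesis
    using assms(2) sets.sets_into_space[of "carrier G" \<mu>] sets.top[of \<mu>] space_closed by auto
qed

end

theory Submission
  imports Defs
begin

text \<open>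
  Let \<open>u\<close> be a bounded \<open>\<mu>\<close>-harmonic function, and let \<open>X\<^sub>t\<close> have law \<open>\<mu>\<^sup>t\<close>. Put
  \<open>F\<^sub>t(\<gamma>) = E (u(X\<^sub>t \<gamma>) - u(X\<^sub>t))\<^sup>2\<close>. Orthogonality of martingale increments gives
  \<open>\<integral> F\<^sub>t d\<mu>\<^sup>k = E u(X\<^sub>t\<^sub>+\<^sub>k)\<^sup>2 - E u(X\<^sub>t)\<^sup>2\<close>, so \<open>\<Sum>\<^sub>t \<integral> F\<^sub>t d\<mu>\<^sup>k\<close> is finite for every \<open>k\<close>.
  Hence \<open>F\<^sub>t \<rightarrow> 0\<close> almost everywhere for every \<open>\<mu>\<^sup>k\<close>, thus also for \<open>\<theta>\<close>, and so
  \<open>\<integral> u d(\<mu>\<^sup>t * \<theta>) - u(e) = E \<integral> (u(X\<^sub>t \<gamma>) - u(X\<^sub>t)) d\<theta>(\<gamma>) \<rightarrow> 0\<close>. On the other hand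
  \<open>\<integral> u d(\<theta> * \<mu>\<^sup>t) = \<integral> u d\<theta>\<close> by harmonicity, and the two convolutions are asymptotically equal.
  Left translates of harmonic functions are harmonic, so the identity at \<open>e\<close> suffices.
\<close>

section \<open>Bounded functions and setwise convergence\<close>

text \<open>Nonnegativity of the variance. It later bounds a mean increment by its second
  moment.\<close>

lemma (in prob_space) expectation_square_le:
  fixes f :: "'a \<Rightarrow> real"
  assumes "integrable M f" "integrable M (\<lambda>x. (f x)\<^sup>2)"
  shows "(expectation f)\<^sup>2 \<le> expectation (\<lambda>x. (f x)\<^sup>2)"
  using variance_eq[OF assms] variance_positive[of f] by simp

lemma (in prob_space) integrable_bounded:
  fixes f :: "'a \<Rightarrow> real"
  assumes "f \<in> borel_measurable M" "\<And>x. x \<in> space M \<Longrightarrow> \<bar>f x\<bar> \<le> C"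
  shows "integrable M f"
  using assms by (intro integrable_const_bound[where B=C]) auto

lemma (in prob_space) abs_expectation_le:
  fixes f :: "'a \<Rightarrow> real"
  assumes "f \<in> borel_measurable M" "\<And>x. x \<in> space M \<Longrightarrow> \<bar>f x\<bar> \<le> C"
  shows "\<bar>expectation f\<bar> \<le> C"
proof -
  have "\<bar>expectation f\<bar> \<le> expectation (\<lambda>x. \<bar>f x\<bar>)"
    using integral_norm_bound[of M f] by simp
  also have "\<dots> \<le> expectation (\<lambda>x. C)"
    using assms integrable_bounded[OF assms] by (intro integral_mono) auto
  finally show ?thesis by (simp add: prob_space)
qed

text \<open>Rounding \<open>f\<close> down to a multiple of \<open>\<epsilon>\<close> gives a simple function which is uniformly close
  to \<open>f\<close>.\<close>

lemma integral_diff_tendsto_0_if_setwise: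
  fixes \<alpha> \<beta> :: "nat \<Rightarrow> 'a measure" and f :: "'a \<Rightarrow> real"
  assumes \<alpha>: "\<And>t. prob_space (\<alpha> t)" "\<And>t. sets (\<alpha> t) = sets M"
    and \<beta>: "\<And>t. prob_space (\<beta> t)" "\<And>t. sets (\<beta> t) = sets M"
    and conv: "\<And>A. A \<in> sets M \<Longrightarrow> (\<lambda>t. measure (\<alpha> t) A - measure (\<beta> t) A) \<longlonglongrightarrow> 0"
    and f: "f \<in> borel_measurable M" and C: "\<And>x. x \<in> space M \<Longrightarrow> \<bar>f x\<bar> \<le> C"
  shows "(\<lambda>t. (\<integral>x. f x \<partial>\<alpha> t) - (\<integral>x. f x \<partial>\<beta> t)) \<longlonglongrightarrow> 0"
proof (rule LIMSEQ_I)
  fix r :: real assume "0 < r"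
  \<comment> \<open>Three errors of size at most \<open>e\<close> add up at the end: two from
    replacing \<open>f\<close> by \<open>s\<close> under \<alpha> and \<beta>, one from the finite
    sum. Their total stays below \<open>r\<close>.\<close>
  define e where "e = r / 4"
  have e: "0 < e" using \<open>0 < r\<close> by (simp add: e_def)
  \<comment> \<open>The bound \<open>C\<close> on \<open>f\<close> confines the floor of
    \<open>f x / e\<close> to this range. It is finite and the same for all \<open>t\<close>, so
    setwise convergence can be summed over it.\<close>
  define K where "K = {\<lfloor>- C / e\<rfloor>..\<lfloor>C / e\<rfloor>}"
  define A where "A k = {x \<in> space M. \<lfloor>f x / e\<rfloor> = k}" for k :: int
  define s where "s x = (\<Sum>k\<in>K. e * of_int k * indicator (A k) x)" for x
  have [measurable]: "A k \<in> sets M" for k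
    unfolding A_def using f by measurable
  have s_eq: "s x = e * of_int \<lfloor>f x / e\<rfloor>" if "x \<in> space M" for x
  proof -
    have "\<lfloor>f x / e\<rfloor> \<in> K"
      using C[OF that] e unfolding K_def atLeastAtMost_iff
      by (intro conjI floor_mono divide_right_mono) auto
    moreover have "s x = (\<Sum>k\<in>K. if k = \<lfloor>f x / e\<rfloor> then e * of_int k else 0)"
      unfolding s_def A_def using that by (intro sum.cong) auto
    ultimately show ?thesis by (simp add: K_def)
  qed
  have close: "\<bar>f x - s x\<bar> \<le> e" if "x \<in> space M" for x
  proof -
    have "\<bar>f x / e - of_int \<lfloor>f x / e\<rfloor>\<bar> \<le> 1" by linarith
    then have "e * \<bar>f x / e - of_int \<lfloor>f x / e\<rfloor>\<bar> \<le> e" using e by simp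
    moreover have "e * \<bar>f x / e - of_int \<lfloor>f x / e\<rfloor>\<bar> = \<bar>e * (f x / e - of_int \<lfloor>f x / e\<rfloor>)\<bar>"
      using e by (simp add: abs_mult)
    ultimately show ?thesis using e by (simp add: s_eq[OF that] right_diff_distrib)
  qed
  have approx: "\<bar>(\<integral>x. f x \<partial>N) - (\<Sum>k\<in>K. e * of_int k * measure N (A k))\<bar> \<le> e"
    if "prob_space N" and N: "sets N = sets M" for N
  proof -
    interpret prob_space N by fact
    note [measurable_cong] = N
    have sp: "space N = space M" by (rule sets_eq_imp_space_eq[OF N])
    have f': "integrable N f"
      using f C by (intro integrable_bounded[where C=C]) (auto simp: sp cong: measurable_cong_sets[OF N])
    have ind: "integrable N (indicat_real (A k))" for k
      by (intro integrable_bounded[where C=1]) (auto simp: indicator_def)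
    have s': "integrable N s"
      unfolding s_def by (intro Bochner_Integration.integrable_sum integrable_mult_right ind)
    have "integral\<^sup>L N s = (\<Sum>k\<in>K. e * of_int k * measure N (A k))"
      unfolding s_def by (subst Bochner_Integration.integral_sum) (auto simp: N ind)
    moreover have "\<bar>\<integral>x. f x - s x \<partial>N\<bar> \<le> e"
      using f' s' close sp by (intro abs_expectation_le) auto
    ultimately show ?thesis using f' s' by simp
  qed
  have "(\<lambda>t. \<Sum>k\<in>K. e * of_int k * (measure (\<alpha> t) (A k) - measure (\<beta> t) (A k))) \<longlonglongrightarrow> 0"
    by (intro tendsto_null_sum tendsto_mult_right_zero conv) auto
  then obtain T where T: "\<And>t. t \<ge> T \<Longrightarrow>
    \<bar>\<Sum>k\<in>K. e * of_int k * (measure (\<alpha> t) (A k) - measure (\<beta> t) (A k))\<bar> < e"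
    using LIMSEQ_D[OF _ e] by fastforce
  have "norm ((\<integral>x. f x \<partial>\<alpha> t) - (\<integral>x. f x \<partial>\<beta> t) - 0) < r" if "t \<ge> T" for t
  proof -
    have "r = 4 * e" by (simp add: e_def)
    then show ?thesis
      using T[OF that] approx[OF \<alpha>(1,2)[of t]] approx[OF \<beta>(1,2)[of t]] e
      unfolding right_diff_distrib sum_subtractf real_norm_def by linarith
  qed
  then show "\<exists>T. \<forall>t\<ge>T. norm ((\<integral>x. f x \<partial>\<alpha> t) - (\<integral>x. f x \<partial>\<beta> t) - 0) < r" by blast
qed

section \<open>Total variation and a telescoping bound\<close>

text \<open>The set \<open>A\<close> and its complement form one of the partitions in the supremum,
  and the term of \<open>A\<close> is part of the corresponding sum.\<close>

lemma abs_le_tv_norm: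
  assumes "A \<in> sets M" "\<nu> {} = 0"
  shows "ennreal \<bar>\<nu> A\<bar> \<le> tv_norm M \<nu>"
proof (cases "A = {}")
  case False
  \<comment> \<open>Blocks of a partition are nonempty, so an empty complement has to be dropped;
    for the same reason \<open>A = {}\<close> is a separate case.\<close>
  define P where "P = {A, space M - A} - {{}}"
  have "partition_on (space M) P"
    using sets.sets_into_space[OF assms(1)]
    by (auto simp: P_def partition_on_def disjoint_def)
  then have "(\<Sum>B\<in>P. ennreal \<bar>\<nu> B\<bar>) \<le> tv_norm M \<nu>"
    unfolding tv_norm_def using assms(1) by (intro SUP_upper) (auto simp: P_def)
  moreover have "ennreal \<bar>\<nu> A\<bar> \<le> (\<Sum>B\<in>P. ennreal \<bar>\<nu> B\<bar>)"
    using False by (intro member_le_sum) (auto simp: P_def)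
  ultimately show ?thesis by order
qed (simp add: assms)

lemma setwise_tendsto_0_if_tv_norm:
  assumes "(\<lambda>t. tv_norm M (\<nu> t)) \<longlonglongrightarrow> 0" "A \<in> sets M" "\<And>t. \<nu> t {} = 0"
  shows "(\<lambda>t. \<nu> t A) \<longlonglongrightarrow> 0"
proof -
  have "(\<lambda>t. ennreal \<bar>\<nu> t A\<bar>) \<longlonglongrightarrow> 0"
    using abs_le_tv_norm[OF assms(2), where \<nu>="\<nu> _", OF assms(3)]
    by (intro tendsto_sandwich[OF _ _ tendsto_const assms(1)]) auto
  then have "(\<lambda>t. \<bar>\<nu> t A\<bar>) \<longlonglongrightarrow> 0"
    using tendsto_ennreal_iff[of "\<lambda>t. \<bar>\<nu> t A\<bar>" sequentially 0] by simp
  then show ?thesis by (simp add: tendsto_rabs_zero_iff)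
qed

text \<open>Telescoping exchanges the two lengths: \<open>T\<close> differences with shift
  \<open>k\<close> have the same sum as \<open>k\<close> differences with shift \<open>T\<close>,
  and each of the latter is at most \<open>B\<close>. The resulting bound is independent of
  \<open>T\<close>, hence survives the passage to an infinite series.\<close>

lemma sum_shift_diff_le:
  fixes a :: "nat \<Rightarrow> real"
  assumes "\<And>n. 0 \<le> a n" "\<And>n. a n \<le> B"
  shows "(\<Sum>t<T. a (t + k) - a t) \<le> real k * B"
proof -
  have "(\<Sum>t<T. a (t + k) - a t) = (\<Sum>j<k. a (T + j) - a j)"
  proof (induction T)
    case (Suc T)
    have "(\<Sum>j<k. a (Suc T + j) - a j) - (\<Sum>j<k. a (T + j) - a j)
        = (\<Sum>j<k. a (T + Suc j) - a (T + j))"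
      by (simp add: sum_subtractf[symmetric])
    also have "\<dots> = a (T + k) - a T"
      using sum_lessThan_telescope[of "\<lambda>j. a (T + j)" k] by simp
    finally show ?case using Suc by simp
  qed simp
  also have "\<dots> \<le> (\<Sum>j<k. B)"
    using assms by (intro sum_mono) (smt (verit))
  finally show ?thesis by simp
qed

section \<open>Convolution\<close>

text \<open>\<open>M\<close> fixes the sigma-algebra shared by all measures under consideration; the
  powers of \<mu>, the measure \<theta> and their convolutions are then probability measures on
  it.\<close>

locale measurable_group = group G for G (structure) +
  fixes M :: "'a measure"
  assumes space_M: "space M = carrier G"
    and measurable_mult: "(\<lambda>(x, y). x \<otimes> y) \<in> M \<Otimes>\<^sub>M M \<rightarrow>\<^sub>M M"
begin

definition prob_on :: "'a measure \<Rightarrow> bool" where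
  "prob_on \<alpha> \<longleftrightarrow> prob_space \<alpha> \<and> sets \<alpha> = sets M"

text \<open>The bound is an explicit parameter because translation and averaging preserve it and it
  supplies the dominating constants later. Only points of the carrier are constrained.\<close>

definition bounded_measurable :: "real \<Rightarrow> ('a \<Rightarrow> real) \<Rightarrow> bool" where
  "bounded_measurable C f \<longleftrightarrow> f \<in> borel_measurable M \<and> (\<forall>x\<in>carrier G. \<bar>f x\<bar> \<le> C)"

lemma prob_onD:
  assumes "prob_on \<alpha>"
  shows "prob_space \<alpha>" "sets \<alpha> = sets M" "space \<alpha> = carrier G"
  using assms sets_eq_imp_space_eq[of \<alpha> M] by (auto simp: prob_on_def space_M)

lemma borel_measurable_pair:
  assumes "prob_on \<alpha>" "prob_on \<beta>" "f \<in> borel_measurable M"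
  shows "(\<lambda>(x, y). f (x \<otimes> y)) \<in> borel_measurable (\<alpha> \<Otimes>\<^sub>M \<beta>)"
proof -
  have "(\<lambda>z. f ((\<lambda>(x, y). x \<otimes> y) z)) \<in> borel_measurable (M \<Otimes>\<^sub>M M)"
    by (rule measurable_compose[OF measurable_mult assms(3)])
  moreover have "sets (\<alpha> \<Otimes>\<^sub>M \<beta>) = sets (M \<Otimes>\<^sub>M M)"
    using assms by (intro sets_pair_measure_cong prob_onD)
  ultimately show ?thesis
    by (simp add: case_prod_beta' cong: measurable_cong_sets)
qed

lemma measurable_translate:
  assumes "g \<in> carrier G" shows "(\<lambda>x. g \<otimes> x) \<in> M \<rightarrow>\<^sub>M M"
  using measurable_compose[OF measurable_Pair1'[of g M M] measurable_mult] assms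
  by (simp add: space_M)

lemma bounded_measurable_translate:
  assumes "bounded_measurable C f" "g \<in> carrier G"
  shows "bounded_measurable C (\<lambda>x. f (g \<otimes> x))"
  using assms measurable_compose[OF measurable_translate[OF assms(2)], of f borel]
  by (auto simp: bounded_measurable_def)

lemma integrable_bounded_measurable:
  assumes "bounded_measurable C f" "prob_on \<alpha>" shows "integrable \<alpha> f"
proof -
  interpret prob_space \<alpha> using assms(2) by (rule prob_onD)
  show ?thesis
    using assms by (intro integrable_bounded[where C=C])
      (auto simp: bounded_measurable_def prob_onD cong: measurable_cong_sets)
qed

lemma bounded_measurable_square:
  assumes "bounded_measurable C f" shows "bounded_measurable (C\<^sup>2) (\<lambda>x. (f x)\<^sup>2)"
  using assms power_mono[of "\<bar>f _\<bar>" C 2] by (auto simp: bounded_measurable_def)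

lemma bounded_measurable_integral:
  assumes "bounded_measurable C f" "prob_on \<beta>"
  shows "bounded_measurable C (\<lambda>x. \<integral>y. f (x \<otimes> y) \<partial>\<beta>)"
proof -
  interpret prob_space \<beta> using assms(2) by (rule prob_onD)
  \<comment> \<open>\<open>borel_measurable_pair\<close> expects probability measures in both
    factors, and \<open>M\<close> is not assumed to be one.\<close>
  have "(\<lambda>(x, y). f (x \<otimes> y)) \<in> borel_measurable (M \<Otimes>\<^sub>M \<beta>)"
  proof -
    have "(\<lambda>z. f ((\<lambda>(x, y). x \<otimes> y) z)) \<in> borel_measurable (M \<Otimes>\<^sub>M M)"
      using assms by (intro measurable_compose[OF measurable_mult]) (auto simp: bounded_measurable_def)
    moreover have "sets (M \<Otimes>\<^sub>M \<beta>) = sets (M \<Otimes>\<^sub>M M)"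
      using assms by (intro sets_pair_measure_cong prob_onD refl)
    ultimately show ?thesis
      by (simp add: case_prod_beta' cong: measurable_cong_sets)
  qed
  then have "(\<lambda>x. \<integral>y. f (x \<otimes> y) \<partial>\<beta>) \<in> borel_measurable M"
    by (rule borel_measurable_lebesgue_integral)
  moreover have "\<bar>\<integral>y. f (x \<otimes> y) \<partial>\<beta>\<bar> \<le> C" if "x \<in> carrier G" for x
    using bounded_measurable_translate[OF assms(1) that] assms(2)
    by (intro abs_expectation_le)
      (auto simp: bounded_measurable_def prob_onD cong: measurable_cong_sets)
  ultimately show ?thesis by (simp add: bounded_measurable_def)
qed

lemma prob_on_convolution:
  assumes "prob_on \<alpha>" "prob_on \<beta>" shows "prob_on (group_convolution G \<alpha> \<beta>)"
proof -
  interpret A: prob_space \<alpha> using assms by (intro prob_onD)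
  interpret B: prob_space \<beta> using assms by (intro prob_onD)
  interpret pair_prob_space \<alpha> \<beta> ..
  have "(\<lambda>(x, y). x \<otimes> y) \<in> \<alpha> \<Otimes>\<^sub>M \<beta> \<rightarrow>\<^sub>M \<alpha>"
    using measurable_mult assms
    by (simp add: prob_onD cong: measurable_cong_sets sets_pair_measure_cong)
  then show ?thesis
    using assms by (auto simp: prob_on_def group_convolution_def intro!: prob_space_distr)
qed

text \<open>Change of variables along the multiplication, followed by Fubini for a bounded
  integrand.\<close>

lemma integral_convolution:
  assumes "prob_on \<alpha>" "prob_on \<beta>" "bounded_measurable C f"
  shows "(\<integral>z. f z \<partial>group_convolution G \<alpha> \<beta>) = (\<integral>x. \<integral>y. f (x \<otimes> y) \<partial>\<beta> \<partial>\<alpha>)"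
proof -
  interpret A: prob_space \<alpha> using assms by (intro prob_onD)
  interpret B: prob_space \<beta> using assms by (intro prob_onD)
  interpret pair_prob_space \<alpha> \<beta> ..
  have m: "(\<lambda>(x, y). x \<otimes> y) \<in> \<alpha> \<Otimes>\<^sub>M \<beta> \<rightarrow>\<^sub>M \<alpha>"
    using measurable_mult assms
    by (simp add: prob_onD cong: measurable_cong_sets sets_pair_measure_cong)
  have f: "f \<in> borel_measurable \<alpha>"
    using assms by (auto simp: bounded_measurable_def prob_onD cong: measurable_cong_sets)
  have "(\<integral>z. f z \<partial>group_convolution G \<alpha> \<beta>) = (\<integral>(x, y). f (x \<otimes> y) \<partial>(\<alpha> \<Otimes>\<^sub>M \<beta>))"
    unfolding group_convolution_def by (subst integral_distr[OF m f]) (simp add: case_prod_beta')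
  also have "\<dots> = (\<integral>x. \<integral>y. f (x \<otimes> y) \<partial>\<beta> \<partial>\<alpha>)"
    using assms
    by (intro integral_fst[symmetric] P.integrable_bounded[where C=C] borel_measurable_pair)
      (auto simp: bounded_measurable_def prob_onD space_pair_measure)
  finally show ?thesis .
qed

lemma prob_on_convolution_power:
  assumes "prob_on \<mu>" shows "prob_on (convolution_power G \<mu> n)"
proof (induction n)
  case 0
  then show ?case
    using assms by (auto simp: prob_on_def prob_onD(3)[OF assms] intro!: prob_space_return)
qed (simp add: prob_on_convolution assms)

text \<open>The semigroup law of convolution powers, tested on bounded functions; in this form
  associativity is needed only inside the group.\<close>

lemma integral_convolution_power_add:
  assumes "prob_on \<mu>" "bounded_measurable C f"
  shows "(\<integral>x. \<integral>y. f (x \<otimes> y) \<partial>convolution_power G \<mu> k \<partial>convolution_power G \<mu> t)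
    = (\<integral>z. f z \<partial>convolution_power G \<mu> (t + k))"
  using assms(2)
\<comment> \<open>Powers grow on the right, so the last factor is integrated out first. The
  induction hypothesis is then applied to the average of \<open>f\<close> over that factor, which is
  why \<open>f\<close> varies.\<close>
proof (induction k arbitrary: f)
  case 0
  have "(\<integral>y. f (x \<otimes> y) \<partial>return \<mu> \<one>) = f x" if "x \<in> carrier G" for x
    using bounded_measurable_translate[OF 0 that] that assms(1)
    by (subst integral_return)
      (auto simp: bounded_measurable_def prob_onD cong: measurable_cong_sets)
  then show ?case
    by (auto simp: prob_onD(3)[OF assms(1)] intro!: Bochner_Integration.integral_cong)
next
  case (Suc k)
  let ?\<mu> = "convolution_power G \<mu>"
  have "(\<integral>y. f (x \<otimes> y) \<partial>?\<mu> (Suc k)) = (\<integral>y. \<integral>z. f (x \<otimes> y \<otimes> z) \<partial>\<mu> \<partial>?\<mu> k)"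
    if x: "x \<in> carrier G" for x
    using bounded_measurable_translate[OF Suc.prems x] x assms(1)
    by (subst convolution_power.simps, subst integral_convolution)
      (auto simp: prob_on_convolution_power prob_onD m_assoc
        intro!: Bochner_Integration.integral_cong)
  then have "(\<integral>x. \<integral>y. f (x \<otimes> y) \<partial>?\<mu> (Suc k) \<partial>?\<mu> t)
      = (\<integral>x. \<integral>y. \<integral>z. f (x \<otimes> y \<otimes> z) \<partial>\<mu> \<partial>?\<mu> k \<partial>?\<mu> t)"
    using assms(1)
    by (intro Bochner_Integration.integral_cong[OF refl]) (auto simp: prob_onD simp del: convolution_power.simps)
  also have "\<dots> = (\<integral>w. \<integral>z. f (w \<otimes> z) \<partial>\<mu> \<partial>?\<mu> (t + k))"
    by (rule Suc.IH) (rule bounded_measurable_integral[OF Suc.prems assms(1)])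
  also have "\<dots> = (\<integral>z. f z \<partial>?\<mu> (t + Suc k))"
    using assms(1) Suc.prems by (simp add: integral_convolution prob_on_convolution_power)
  finally show ?case .
qed

section \<open>Bounded harmonic functions\<close>

text \<open>Harmonicity at the point \<open>g \<otimes> x\<close> averages away the last factor of
  the power, leaving one factor fewer.\<close>

lemma harmonic_convolution_power:
  assumes "prob_on \<mu>" "bounded_measurable C u"
    and harm: "\<forall>x\<in>carrier G. u x = (\<integral>y. u (x \<otimes> y) \<partial>\<mu>)"
    and g: "g \<in> carrier G"
  shows "(\<integral>y. u (g \<otimes> y) \<partial>convolution_power G \<mu> n) = u g"
proof (induction n)
  case 0
  then show ?case
    using bounded_measurable_translate[OF assms(2) g] g assms(1)
    by (simp, subst integral_return)
      (auto simp: bounded_measurable_def prob_onD cong: measurable_cong_sets)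
next
  case (Suc n)
  have "(\<integral>y. u (g \<otimes> y) \<partial>convolution_power G \<mu> (Suc n))
      = (\<integral>x. \<integral>y. u (g \<otimes> (x \<otimes> y)) \<partial>\<mu> \<partial>convolution_power G \<mu> n)"
    using bounded_measurable_translate[OF assms(2) g] assms(1)
    by (simp add: integral_convolution prob_on_convolution_power)
  also have "\<dots> = (\<integral>x. u (g \<otimes> x) \<partial>convolution_power G \<mu> n)"
  proof (rule Bochner_Integration.integral_cong)
    fix x assume "x \<in> space (convolution_power G \<mu> n)"
    then have x: "x \<in> carrier G" using assms(1) by (simp add: prob_onD)
    have "(\<integral>y. u (g \<otimes> (x \<otimes> y)) \<partial>\<mu>) = (\<integral>y. u (g \<otimes> x \<otimes> y) \<partial>\<mu>)"
      using g x assms(1) by (intro Bochner_Integration.integral_cong) (auto simp: prob_onD m_assoc)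
    then show "(\<integral>y. u (g \<otimes> (x \<otimes> y)) \<partial>\<mu>) = u (g \<otimes> x)"
      using bspec[OF harm, of "g \<otimes> x"] g x by simp
  qed simp
  finally show ?case using Suc by simp
qed

section \<open>Squared increments along the random walk\<close>

text \<open>For \<alpha> the law of \<open>X\<^sub>t\<close> this is \<open>F\<^sub>t\<close>. It is
  kept as a function of the right factor \<open>y\<close>, because the exceptional null sets concern
  \<open>y\<close>.\<close>

definition sq_increment :: "('a \<Rightarrow> real) \<Rightarrow> 'a measure \<Rightarrow> 'a \<Rightarrow> real" where
  "sq_increment u \<alpha> y = (\<integral>x. (u (x \<otimes> y) - u x)\<^sup>2 \<partial>\<alpha>)"

lemma borel_measurable_increment:
  assumes "prob_on \<alpha>" "prob_on \<beta>" "bounded_measurable C u"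
  shows "(\<lambda>(x, y). u (x \<otimes> y) - u x) \<in> borel_measurable (\<alpha> \<Otimes>\<^sub>M \<beta>)"
proof -
  have "u \<in> borel_measurable \<alpha>"
    using assms by (auto simp: bounded_measurable_def prob_onD cong: measurable_cong_sets)
  then have "(\<lambda>z. u (fst z)) \<in> borel_measurable (\<alpha> \<Otimes>\<^sub>M \<beta>)" by measurable
  then show ?thesis
    using borel_measurable_diff[OF borel_measurable_pair[OF assms(1,2), of u]] assms(3)
    by (simp add: bounded_measurable_def case_prod_beta')
qed

lemma abs_increment_le:
  assumes "bounded_measurable C u" "x \<in> carrier G" "y \<in> carrier G"
  shows "\<bar>u (x \<otimes> y) - u x\<bar> \<le> 2 * C" "(u (x \<otimes> y) - u x)\<^sup>2 \<le> (2 * C)\<^sup>2"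
proof -
  have "\<bar>u (x \<otimes> y)\<bar> \<le> C" "\<bar>u x\<bar> \<le> C"
    using assms by (auto simp: bounded_measurable_def)
  then show *: "\<bar>u (x \<otimes> y) - u x\<bar> \<le> 2 * C" by linarith
  show "(u (x \<otimes> y) - u x)\<^sup>2 \<le> (2 * C)\<^sup>2"
    using power_mono[OF *, of 2] by simp
qed

lemma integrable_increment:
  assumes "prob_on \<alpha>" "prob_on \<beta>" "bounded_measurable C u"
  shows "integrable (\<alpha> \<Otimes>\<^sub>M \<beta>) (\<lambda>(x, y). u (x \<otimes> y) - u x)"
    and "integrable (\<alpha> \<Otimes>\<^sub>M \<beta>) (\<lambda>(x, y). (u (x \<otimes> y) - u x)\<^sup>2)"
proof -
  interpret A: prob_space \<alpha> using assms by (intro prob_onD)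
  interpret B: prob_space \<beta> using assms by (intro prob_onD)
  interpret pair_prob_space \<alpha> \<beta> ..
  note m = borel_measurable_increment[OF assms]
  show "integrable (\<alpha> \<Otimes>\<^sub>M \<beta>) (\<lambda>(x, y). u (x \<otimes> y) - u x)"
    using abs_increment_le[OF assms(3)] assms
    by (intro P.integrable_bounded[OF m, where C="2*C"]) (auto simp: space_pair_measure prob_onD)
  show "integrable (\<alpha> \<Otimes>\<^sub>M \<beta>) (\<lambda>(x, y). (u (x \<otimes> y) - u x)\<^sup>2)"
    using abs_increment_le(2)[OF assms(3)] assms borel_measurable_power[OF m, of 2]
    by (intro P.integrable_bounded[where C="(2*C)\<^sup>2"])
      (auto simp: space_pair_measure prob_onD case_prod_beta')
qed

lemma sq_increment_bounds:
  assumes "prob_on \<alpha>" "bounded_measurable C u"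
  shows "sq_increment u \<alpha> \<in> borel_measurable M" "0 \<le> sq_increment u \<alpha> y"
    and "y \<in> carrier G \<Longrightarrow> sq_increment u \<alpha> y \<le> (2 * C)\<^sup>2"
proof -
  interpret A: prob_space \<alpha> using assms by (intro prob_onD)
  \<comment> \<open>Measurability in \<open>y\<close> depends only on the sigma-algebra, so \<alpha>
    itself can stand in for the second measure.\<close>
  interpret pair_prob_space \<alpha> \<alpha> ..
  have "(\<lambda>y. \<integral>x. (\<lambda>(x, y). (u (x \<otimes> y) - u x)\<^sup>2) (x, y) \<partial>\<alpha>) \<in> borel_measurable \<alpha>"
    using borel_measurable_integrable[OF integrable_increment(2)[OF assms(1,1,2)]]
    by (intro A.borel_measurable_lebesgue_integral measurable_pair_swap)
  then show "sq_increment u \<alpha> \<in> borel_measurable M"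
    using assms(1) by (simp add: sq_increment_def[abs_def] prob_onD cong: measurable_cong_sets)
  show "0 \<le> sq_increment u \<alpha> y"
    unfolding sq_increment_def by (intro Bochner_Integration.integral_nonneg) auto
  assume y: "y \<in> carrier G"
  have "(\<lambda>x. (x, y)) \<in> \<alpha> \<rightarrow>\<^sub>M \<alpha> \<Otimes>\<^sub>M \<alpha>" using y assms by (simp add: prob_onD)
  from measurable_compose[OF this
    borel_measurable_integrable[OF integrable_increment(2)[OF assms(1,1,2)]]]
  have "\<bar>sq_increment u \<alpha> y\<bar> \<le> (2 * C)\<^sup>2"
    unfolding sq_increment_def using abs_increment_le(2)[OF assms(2)] y assms
    by (intro A.abs_expectation_le) (auto simp: prob_onD)
  then show "sq_increment u \<alpha> y \<le> (2 * C)\<^sup>2" by simp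
qed

lemma integral_sq_increment:
  assumes "prob_on \<alpha>" "prob_on \<beta>" "bounded_measurable C u"
  shows "(\<integral>y. sq_increment u \<alpha> y \<partial>\<beta>) = (\<integral>x. \<integral>y. (u (x \<otimes> y) - u x)\<^sup>2 \<partial>\<beta> \<partial>\<alpha>)"
proof -
  interpret A: prob_space \<alpha> using assms by (intro prob_onD)
  interpret B: prob_space \<beta> using assms by (intro prob_onD)
  interpret pair_prob_space \<alpha> \<beta> ..
  show ?thesis
    unfolding sq_increment_def
    using Fubini_integral[OF integrable_increment(2)[OF assms]] by simp
qed

text \<open>This is orthogonality of martingale increments. For fixed \<open>x\<close> the mean of
  \<open>u (x \<otimes> y)\<close> is \<open>u x\<close>, so the cross term of the expanded square
  is \<open>- 2 * (u x)\<^sup>2\<close> and one \<open>- (u x)\<^sup>2\<close> remains; integration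
  over \<open>x\<close> and the semigroup law finish.\<close>

lemma integral_sq_increment_harmonic:
  assumes \<mu>: "prob_on \<mu>" and u: "bounded_measurable C u"
    and harm: "\<forall>x\<in>carrier G. u x = (\<integral>y. u (x \<otimes> y) \<partial>\<mu>)"
  shows "(\<integral>y. sq_increment u (convolution_power G \<mu> t) y \<partial>convolution_power G \<mu> k)
    = (\<integral>x. (u x)\<^sup>2 \<partial>convolution_power G \<mu> (t + k)) - (\<integral>x. (u x)\<^sup>2 \<partial>convolution_power G \<mu> t)"
proof -
  let ?\<mu> = "convolution_power G \<mu>"
  note P = prob_on_convolution_power[OF \<mu>]
  note u2 = bounded_measurable_square[OF u]
  have "(\<integral>y. (u (x \<otimes> y) - u x)\<^sup>2 \<partial>?\<mu> k) = (\<integral>y. (u (x \<otimes> y))\<^sup>2 \<partial>?\<mu> k) - (u x)\<^sup>2"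
    if x: "x \<in> carrier G" for x
  proof -
    interpret prob_space "?\<mu> k" using P by (rule prob_onD)
    have [simp]: "integrable (?\<mu> k) (\<lambda>y. u (x \<otimes> y))" "integrable (?\<mu> k) (\<lambda>y. (u (x \<otimes> y))\<^sup>2)"
      using bounded_measurable_translate[OF u x] bounded_measurable_translate[OF u2 x] P
      by (auto intro: integrable_bounded_measurable)
    have [simp]: "(\<integral>y. u (x \<otimes> y) \<partial>?\<mu> k) = u x"
      by (rule harmonic_convolution_power[OF \<mu> u harm x])
    have "(\<integral>y. (u (x \<otimes> y) - u x)\<^sup>2 \<partial>?\<mu> k)
        = (\<integral>y. (u (x \<otimes> y))\<^sup>2 - 2 * u x * u (x \<otimes> y) + (u x)\<^sup>2 \<partial>?\<mu> k)"
      by (simp add: power2_diff algebra_simps)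
    also have "\<dots> = (\<integral>y. (u (x \<otimes> y))\<^sup>2 \<partial>?\<mu> k) - 2 * u x * u x + (u x)\<^sup>2"
      using prob_space by simp
    finally show ?thesis by (simp add: power2_eq_square)
  qed
  then have "(\<integral>y. sq_increment u (?\<mu> t) y \<partial>?\<mu> k)
      = (\<integral>x. (\<integral>y. (u (x \<otimes> y))\<^sup>2 \<partial>?\<mu> k) - (u x)\<^sup>2 \<partial>?\<mu> t)"
    unfolding integral_sq_increment[OF P P u]
    using \<mu> by (intro Bochner_Integration.integral_cong) (auto simp: prob_onD)
  also have "\<dots> = (\<integral>x. \<integral>y. (u (x \<otimes> y))\<^sup>2 \<partial>?\<mu> k \<partial>?\<mu> t) - (\<integral>x. (u x)\<^sup>2 \<partial>?\<mu> t)"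
    by (intro Bochner_Integration.integral_diff integrable_bounded_measurable[where C="C\<^sup>2"] P u2
        bounded_measurable_integral)
  also have "(\<integral>x. \<integral>y. (u (x \<otimes> y))\<^sup>2 \<partial>?\<mu> k \<partial>?\<mu> t) = (\<integral>x. (u x)\<^sup>2 \<partial>?\<mu> (t + k))"
    by (rule integral_convolution_power_add[OF \<mu> u2])
  finally show ?thesis .
qed

text \<open>The integral of the whole series is at most \<open>k * C\<^sup>2\<close> by the
  telescoping bound, so the series is finite almost everywhere. Such a statement about null sets can
  be carried over to \<theta> by absolute continuity.\<close>

lemma AE_suminf_sq_increment_finite:
  assumes \<mu>: "prob_on \<mu>" and u: "bounded_measurable C u"
    and harm: "\<forall>x\<in>carrier G. u x = (\<integral>y. u (x \<otimes> y) \<partial>\<mu>)"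
  shows "AE y in convolution_power G \<mu> k.
    (\<Sum>t. ennreal (sq_increment u (convolution_power G \<mu> t) y)) \<noteq> \<infinity>"
proof -
  let ?\<mu> = "convolution_power G \<mu>" and ?F = "\<lambda>t. sq_increment u (convolution_power G \<mu> t)"
  note P = prob_on_convolution_power[OF \<mu>]
  note F = sq_increment_bounds[OF P u]
  interpret prob_space "?\<mu> k" using P by (rule prob_onD)
  have meas [measurable]: "?F t \<in> borel_measurable (?\<mu> k)" for t
    using F(1) \<mu> by (simp add: prob_onD cong: measurable_cong_sets)
  \<comment> \<open>Second moments of the bounded martingale \<open>u(X\<^sub>n)\<close>, all lying
    between 0 and \<open>C\<^sup>2\<close>.\<close>
  define a where "a n = (\<integral>x. (u x)\<^sup>2 \<partial>?\<mu> n)" for n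
  have a: "0 \<le> a n" "a n \<le> C\<^sup>2" for n
  proof -
    interpret N: prob_space "?\<mu> n" using P by (rule prob_onD)
    show "0 \<le> a n" unfolding a_def by (intro Bochner_Integration.integral_nonneg) auto
    have "\<bar>a n\<bar> \<le> C\<^sup>2"
      unfolding a_def using bounded_measurable_square[OF u] P[of n]
      by (intro N.abs_expectation_le)
        (auto simp: bounded_measurable_def prob_onD[OF \<mu>] cong: measurable_cong_sets)
    then show "a n \<le> C\<^sup>2" by simp
  qed
  have nn_int: "(\<integral>\<^sup>+y. ennreal (?F t y) \<partial>?\<mu> k) = ennreal (a (t + k) - a t)" for t
  proof -
    have "integrable (?\<mu> k) (?F t)"
      using F(2,3) \<mu> by (intro integrable_bounded[where C="(2*C)\<^sup>2"]) (auto simp: prob_onD)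
    then show ?thesis
      using integral_sq_increment_harmonic[OF \<mu> u harm, where t=t and k=k] F(2)
      by (subst nn_integral_eq_integral) (auto simp: a_def)
  qed
  \<comment> \<open>\<open>ennreal\<close> sends negative numbers to 0, so the sign is needed before
    the sum can be moved inside it.\<close>
  have nn: "0 \<le> a (t + k) - a t" for t
    using integral_sq_increment_harmonic[OF \<mu> u harm, where t=t and k=k] F(2)
      Bochner_Integration.integral_nonneg[of "?\<mu> k" "?F t"] by (simp add: a_def)
  have "(\<integral>\<^sup>+y. (\<Sum>t. ennreal (?F t y)) \<partial>?\<mu> k) = (\<Sum>t. ennreal (a (t + k) - a t))"
    by (simp add: nn_integral_suminf nn_int)
  also have "\<dots> \<le> ennreal (real k * C\<^sup>2)"
  proof (rule suminf_le_const)
    fix T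
    have "(\<Sum>t<T. ennreal (a (t + k) - a t)) = ennreal (\<Sum>t<T. a (t + k) - a t)"
      using nn by (intro sum_ennreal) auto
    also have "\<dots> \<le> ennreal (real k * C\<^sup>2)"
      by (intro ennreal_leI sum_shift_diff_le a)
    finally show "(\<Sum>t<T. ennreal (a (t + k) - a t)) \<le> ennreal (real k * C\<^sup>2)" .
  qed simp
  also have "\<dots> < \<infinity>" by simp
  finally have "(\<integral>\<^sup>+y. (\<Sum>t. ennreal (?F t y)) \<partial>?\<mu> k) \<noteq> \<infinity>" by simp
  then show ?thesis
    by (intro nn_integral_PInf_AE) auto
qed

lemma integral_sq_increment_tendsto_0:
  assumes \<mu>: "prob_on \<mu>" and \<theta>: "prob_on \<theta>"
    and ac: "absolutely_continuous (geometric_mixture G \<mu>) \<theta>"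
    and u: "bounded_measurable C u"
    and harm: "\<forall>x\<in>carrier G. u x = (\<integral>y. u (x \<otimes> y) \<partial>\<mu>)"
  shows "(\<lambda>t. \<integral>y. sq_increment u (convolution_power G \<mu> t) y \<partial>\<theta>) \<longlonglongrightarrow> 0"
proof -
  let ?F = "\<lambda>t. sq_increment u (convolution_power G \<mu> t)"
  note P = prob_on_convolution_power[OF \<mu>]
  note F = sq_increment_bounds[OF P u]
  interpret prob_space \<theta> using \<theta> by (rule prob_onD)
  \<comment> \<open>A single set serves all \<open>k\<close>. Being null for every convolution
    power, it is null for the geometric mixture and therefore for \<theta>; off it the terms of the
    series tend to 0.\<close>
  define N where "N = {y \<in> space M. (\<Sum>t. ennreal (?F t y)) = \<infinity>}"
  have [measurable]: "?F t \<in> borel_measurable M" for t by (rule F)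
  have N: "N \<in> sets M" unfolding N_def by measurable
  have "emeasure (convolution_power G \<mu> k) N = 0" for k
    using AE_suminf_sq_increment_finite[OF \<mu> u harm, of k] N \<mu>
    by (subst (asm) AE_iff_measurable[where N=N]) (auto simp: N_def space_M prob_onD)
  then have "N \<in> null_sets (geometric_mixture G \<mu>)"
    using N \<mu> by (intro null_setsI) (auto simp: emeasure_geometric_mixture prob_onD)
  then have "N \<in> null_sets \<theta>"
    using ac by (auto simp: absolutely_continuous_def)
  then have "AE y in \<theta>. y \<notin> N" by (rule AE_not_in)
  then have "AE y in \<theta>. (\<lambda>t. ?F t y) \<longlonglongrightarrow> 0"
  proof (rule AE_mp, intro AE_I2 impI)
    fix y assume "y \<in> space \<theta>" "y \<notin> N"
    then have "(\<Sum>t. ennreal (?F t y)) \<noteq> \<infinity>"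
      using \<theta> by (simp add: N_def space_M prob_onD)
    then have "summable (\<lambda>t. ?F t y)"
      using F(2) by (intro summable_suminf_not_top) auto
    then show "(\<lambda>t. ?F t y) \<longlonglongrightarrow> 0" by (rule summable_LIMSEQ_zero)
  qed
  then have "(\<lambda>t. \<integral>y. ?F t y \<partial>\<theta>) \<longlonglongrightarrow> (\<integral>y. 0 \<partial>\<theta>)"
    using F \<theta> by (intro integral_dominated_convergence[where w="\<lambda>_. (2 * C)\<^sup>2"])
      (auto simp: prob_onD cong: measurable_cong_sets)
  then show ?thesis by simp
qed

section \<open>Comparing the two orders of convolution\<close>

text \<open>The deviation from \<open>u \<one>\<close> is the mean of
  \<open>u (x \<otimes> y) - u x\<close> under the product measure. Its square is at most the second
  moment, which is the \<theta>-integral of \<open>sq_increment\<close> and tends to 0.\<close>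

lemma integral_convolution_power_left_tendsto:
  assumes \<mu>: "prob_on \<mu>" and \<theta>: "prob_on \<theta>"
    and ac: "absolutely_continuous (geometric_mixture G \<mu>) \<theta>"
    and u: "bounded_measurable C u"
    and harm: "\<forall>x\<in>carrier G. u x = (\<integral>y. u (x \<otimes> y) \<partial>\<mu>)"
  shows "(\<lambda>t. \<integral>z. u z \<partial>group_convolution G (convolution_power G \<mu> t) \<theta>) \<longlonglongrightarrow> u \<one>"
proof -
  let ?\<mu> = "convolution_power G \<mu>"
  note P = prob_on_convolution_power[OF \<mu>]
  define d where "d t = (\<integral>z. u z \<partial>group_convolution G (?\<mu> t) \<theta>) - u \<one>" for t
  have "(d t)\<^sup>2 \<le> (\<integral>y. sq_increment u (?\<mu> t) y \<partial>\<theta>)" for t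
  proof -
    interpret A: prob_space "?\<mu> t" using P by (rule prob_onD)
    interpret B: prob_space \<theta> using \<theta> by (rule prob_onD)
    interpret pair_prob_space "?\<mu> t" \<theta> ..
    note int = integrable_increment[OF P[of t] \<theta> u]
    \<comment> \<open>Harmonicity at the identity rewrites the constant \<open>u \<one>\<close> as a
      mean over the walk, which turns \<open>d t\<close> into a mean of increments.\<close>
    have "(\<integral>x. u x \<partial>?\<mu> t) = (\<integral>x. u (\<one> \<otimes> x) \<partial>?\<mu> t)"
      using \<mu> by (intro Bochner_Integration.integral_cong) (auto simp: prob_onD)
    also have "\<dots> = u \<one>" by (rule harmonic_convolution_power[OF \<mu> u harm one_closed])
    finally have "d t = (\<integral>x. \<integral>y. u (x \<otimes> y) \<partial>\<theta> \<partial>?\<mu> t) - (\<integral>x. u x \<partial>?\<mu> t)"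
      by (simp add: d_def integral_convolution[OF P \<theta> u])
    also have "\<dots> = (\<integral>x. (\<integral>y. u (x \<otimes> y) \<partial>\<theta>) - u x \<partial>?\<mu> t)"
      by (intro Bochner_Integration.integral_diff[symmetric] integrable_bounded_measurable[where C=C]
          P u \<theta> bounded_measurable_integral)
    also have "\<dots> = (\<integral>x. \<integral>y. u (x \<otimes> y) - u x \<partial>\<theta> \<partial>?\<mu> t)"
    proof (rule Bochner_Integration.integral_cong)
      fix x assume "x \<in> space (?\<mu> t)"
      then have "x \<in> carrier G" using \<mu> by (simp add: prob_onD)
      then have "integrable \<theta> (\<lambda>y. u (x \<otimes> y))"
        by (intro integrable_bounded_measurable[OF bounded_measurable_translate[OF u] \<theta>])
      then show "(\<integral>y. u (x \<otimes> y) \<partial>\<theta>) - u x = (\<integral>y. u (x \<otimes> y) - u x \<partial>\<theta>)"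
        by (simp add: B.prob_space)
    qed simp
    also have "\<dots> = (\<integral>(x, y). u (x \<otimes> y) - u x \<partial>(?\<mu> t \<Otimes>\<^sub>M \<theta>))"
      by (rule integral_fst[OF int(1)])
    finally have "(d t)\<^sup>2 \<le> (\<integral>(x, y). (u (x \<otimes> y) - u x)\<^sup>2 \<partial>(?\<mu> t \<Otimes>\<^sub>M \<theta>))"
      using P.expectation_square_le[OF int(1)] int(2) by (simp add: case_prod_beta')
    also have "\<dots> = (\<integral>x. \<integral>y. (u (x \<otimes> y) - u x)\<^sup>2 \<partial>\<theta> \<partial>?\<mu> t)"
      by (rule integral_fst[OF int(2), symmetric])
    also have "\<dots> = (\<integral>y. sq_increment u (?\<mu> t) y \<partial>\<theta>)"
      by (rule integral_sq_increment[OF P \<theta> u, symmetric])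
    finally show ?thesis .
  qed
  then have "(\<lambda>t. (d t)\<^sup>2) \<longlonglongrightarrow> 0"
    by (intro tendsto_sandwich[OF _ _ tendsto_const
          integral_sq_increment_tendsto_0[OF \<mu> \<theta> ac u harm]]) auto
  then have "d \<longlonglongrightarrow> 0" by simp
  then show ?thesis unfolding d_def by (simp add: LIM_zero_iff)
qed

text \<open>Here the walk comes after \<theta>, so harmonicity at each starting point removes it
  exactly, for every \<open>t\<close>.\<close>

lemma integral_convolution_power_right:
  assumes \<mu>: "prob_on \<mu>" and \<theta>: "prob_on \<theta>" and u: "bounded_measurable C u"
    and harm: "\<forall>x\<in>carrier G. u x = (\<integral>y. u (x \<otimes> y) \<partial>\<mu>)"
  shows "(\<integral>z. u z \<partial>group_convolution G \<theta> (convolution_power G \<mu> t)) = (\<integral>x. u x \<partial>\<theta>)"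
  unfolding integral_convolution[OF \<theta> prob_on_convolution_power[OF \<mu>] u]
  using \<theta> harmonic_convolution_power[OF \<mu> u harm]
  by (intro Bochner_Integration.integral_cong) (auto simp: prob_onD)

lemma harmonic_integral_one:
  assumes \<mu>: "prob_on \<mu>" and \<theta>: "prob_on \<theta>"
    and ac: "absolutely_continuous (geometric_mixture G \<mu>) \<theta>"
    and tv: "(\<lambda>t. tv_norm \<mu> (\<lambda>A.
            measure (group_convolution G \<theta> (convolution_power G \<mu> t)) A
          - measure (group_convolution G (convolution_power G \<mu> t) \<theta>) A)) \<longlonglongrightarrow> 0"
    and u: "bounded_measurable C u"
    and harm: "\<forall>x\<in>carrier G. u x = (\<integral>y. u (x \<otimes> y) \<partial>\<mu>)"
  shows "(\<integral>x. u x \<partial>\<theta>) = u \<one>"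
proof -
  let ?R = "\<lambda>t. group_convolution G \<theta> (convolution_power G \<mu> t)"
    and ?L = "\<lambda>t. group_convolution G (convolution_power G \<mu> t) \<theta>"
  note P = prob_on_convolution_power[OF \<mu>]
  have "(\<lambda>t. (\<integral>z. u z \<partial>?R t) - (\<integral>z. u z \<partial>?L t)) \<longlonglongrightarrow> 0"
  proof (rule integral_diff_tendsto_0_if_setwise[where M=M and C=C])
    show "(\<lambda>t. measure (?R t) A - measure (?L t) A) \<longlonglongrightarrow> 0" if "A \<in> sets M" for A
      using setwise_tendsto_0_if_tv_norm[OF tv, of A] that \<mu> by (simp add: prob_onD)
  qed (use \<mu> \<theta> u P prob_on_convolution in
      \<open>auto simp: prob_onD bounded_measurable_def space_M\<close>)
  then have "(\<lambda>t. (\<integral>x. u x \<partial>\<theta>) - (\<integral>z. u z \<partial>?L t)) \<longlonglongrightarrow> 0"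
    by (simp add: integral_convolution_power_right[OF \<mu> \<theta> u harm])
  moreover have "(\<lambda>t. (\<integral>x. u x \<partial>\<theta>) - (\<integral>z. u z \<partial>?L t)) \<longlonglongrightarrow> (\<integral>x. u x \<partial>\<theta>) - u \<one>"
    by (intro tendsto_intros integral_convolution_power_left_tendsto[OF \<mu> \<theta> ac u harm])
  \<comment> \<open>The same sequence tends to 0 and to the difference of the two sides.\<close>
  ultimately show ?thesis
    using LIMSEQ_unique by fastforce
qed

text \<open>The left translate of \<open>u\<close> by \<open>g\<close> is harmonic with the same
  bound, and its value at the identity is \<open>u g\<close>.\<close>

lemma harmonic_integral_eq:
  assumes "prob_on \<mu>" "prob_on \<theta>"
    and "absolutely_continuous (geometric_mixture G \<mu>) \<theta>"
    and "(\<lambda>t. tv_norm \<mu> (\<lambda>A.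
            measure (group_convolution G \<theta> (convolution_power G \<mu> t)) A
          - measure (group_convolution G (convolution_power G \<mu> t) \<theta>) A)) \<longlonglongrightarrow> 0"
    and u: "bounded_measurable C u"
    and harm: "\<forall>x\<in>carrier G. u x = (\<integral>y. u (x \<otimes> y) \<partial>\<mu>)"
    and g: "g \<in> carrier G"
  shows "(\<integral>x. u (g \<otimes> x) \<partial>\<theta>) = u g"
proof -
  have "(\<integral>x. u (g \<otimes> x) \<partial>\<theta>) = u (g \<otimes> \<one>)"
  proof (intro harmonic_integral_one[OF assms(1-4) bounded_measurable_translate[OF u g]] ballI)
    fix x assume x: "x \<in> carrier G"
    have "(\<integral>y. u (g \<otimes> (x \<otimes> y)) \<partial>\<mu>) = (\<integral>y. u (g \<otimes> x \<otimes> y) \<partial>\<mu>)"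
      using g x assms(1) by (intro Bochner_Integration.integral_cong) (auto simp: prob_onD m_assoc)
    then show "u (g \<otimes> x) = (\<integral>y. u (g \<otimes> (x \<otimes> y)) \<partial>\<mu>)"
      using bspec[OF harm, of "g \<otimes> x"] g x by simp
  qed
  then show ?thesis using g by simp
qed

end

section \<open>Passage to complex-valued functions\<close>

theorem theorem1:
  fixes G :: "('a, 'b) monoid_scheme" and S :: "'a set set" and \<mu> \<theta> :: "'a measure"
  assumes "group G"
    and "invariant_sigma_algebra G S"
    and "measurable_mult G S"
    and "prob_space \<mu>" and "sets \<mu> = S"
    and "prob_space \<theta>" and "sets \<theta> = S"
    and "absolutely_continuous (geometric_mixture G \<mu>) \<theta>"
    and "(\<lambda>t. tv_norm \<mu> (\<lambda>A.
            measure (group_convolution G \<theta> (convolution_power G \<mu> t)) A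
          - measure (group_convolution G (convolution_power G \<mu> t) \<theta>) A))
         \<longlonglongrightarrow> 0"
  shows "H_infinity G \<mu> \<subseteq> H_infinity G \<theta>"
proof
  fix h assume "h \<in> H_infinity G \<mu>"
  then have h: "h \<in> borel_measurable \<mu>"
    and int: "\<And>g. g \<in> carrier G \<Longrightarrow> integrable \<mu> (\<lambda>\<gamma>. h (g \<otimes>\<^bsub>G\<^esub> \<gamma>))"
    and harm: "\<And>g. g \<in> carrier G \<Longrightarrow> h g = (\<integral>\<gamma>. h (g \<otimes>\<^bsub>G\<^esub> \<gamma>) \<partial>\<mu>)"
    and bdd: "bounded (h ` carrier G)"
    by (auto simp: H_infinity_def harmonic_def)
  from bdd obtain C where C: "\<And>x. x \<in> carrier G \<Longrightarrow> cmod (h x) \<le> C"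
    by (auto simp: bounded_iff)
  have space: "space \<mu> = carrier G"
    by (rule sets_eq_imp_space_carrier[OF assms(2,5)])
  \<comment> \<open>\<open>measurable_mult\<close> speaks of the sigma-algebra generated by
    \<open>S\<close>; as \<open>S\<close> is already a sigma-algebra on the carrier, nothing is
    added.\<close>
  have sig: "sets (sigma (carrier G) S) = sets \<mu>"
    using sets.sigma_sets_eq[of \<mu>] sets.space_closed[of \<mu>] assms(5) space by simp
  have "(\<lambda>(x, y). x \<otimes>\<^bsub>G\<^esub> y) \<in> \<mu> \<Otimes>\<^sub>M \<mu> \<rightarrow>\<^sub>M \<mu>"
    using assms(3) unfolding measurable_mult_def
    by (simp add: sig cong: measurable_cong_sets sets_pair_measure_cong)
  then interpret measurable_group G \<mu>
    using assms(1) space by (intro measurable_group.intro measurable_group_axioms.intro)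
  have \<mu>: "prob_on \<mu>" and \<theta>: "prob_on \<theta>"
    using assms by (auto simp: prob_on_def)
  interpret T: prob_space \<theta> by fact
  \<comment> \<open>The martingale argument squares real functions, so real and imaginary parts are
    treated separately; both inherit the bound \<open>C\<close>.\<close>
  have Re: "bounded_measurable C (\<lambda>x. Re (h x))" and Im: "bounded_measurable C (\<lambda>x. Im (h x))"
    using h order_trans[OF abs_Re_le_cmod C] order_trans[OF abs_Im_le_cmod C]
    by (auto simp: bounded_measurable_def)
  have int': "integrable \<theta> (\<lambda>\<gamma>. h (g \<otimes>\<^bsub>G\<^esub> \<gamma>))" if g: "g \<in> carrier G" for g
    using measurable_compose[OF measurable_translate[OF g] h] \<theta> g C
    by (intro T.integrable_const_bound[where B=C])
      (auto simp: prob_onD cong: measurable_cong_sets)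
  have "h g = (\<integral>\<gamma>. h (g \<otimes>\<^bsub>G\<^esub> \<gamma>) \<partial>\<theta>)" if g: "g \<in> carrier G" for g
  proof (rule complex_eqI)
    have "\<forall>x\<in>carrier G. Re (h x) = (\<integral>y. Re (h (x \<otimes>\<^bsub>G\<^esub> y)) \<partial>\<mu>)"
      using harm integral_Re[OF int] by simp
    from harmonic_integral_eq[OF \<mu> \<theta> assms(8,9) Re this g]
    show "Re (h g) = Re (\<integral>\<gamma>. h (g \<otimes>\<^bsub>G\<^esub> \<gamma>) \<partial>\<theta>)"
      using integral_Re[OF int'[OF g]] by simp
    have "\<forall>x\<in>carrier G. Im (h x) = (\<integral>y. Im (h (x \<otimes>\<^bsub>G\<^esub> y)) \<partial>\<mu>)"
      using harm integral_Im[OF int] by simp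
    from harmonic_integral_eq[OF \<mu> \<theta> assms(8,9) Im this g]
    show "Im (h g) = Im (\<integral>\<gamma>. h (g \<otimes>\<^bsub>G\<^esub> \<gamma>) \<partial>\<theta>)"
      using integral_Im[OF int'[OF g]] by simp
  qed
  then show "h \<in> H_infinity G \<theta>"
    using h int' bdd \<theta> by (auto simp: H_infinity_def harmonic_def prob_onD cong: measurable_cong_sets)
qed

end
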